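(* Every infinite even-integer continued fraction (EICF) $[b_1,b_2,\dotsc]$ converges, and its value is either an irrational real number or a $1$-rational.
   Context: $\mathbb{R}_\infty=\mathbb{R}\cup\{\infty\}$ is the extended real line. An even-integer continued fraction (EICF) is a finite, infinite or empty sequence $[b_1,b_2,\dotsc]$ of even integers all of whose terms, except possibly $b_1$, are nonzero. The value of a finite EICF $[b_1,\dots,b_n]$ ($n\geq 1$) is the number $b_1+\cfrac{1}{b_2+\cfrac{1}{b_3+\cdots+\cfrac{1}{b_n}}}$. The convergents of an EICF $[b_1,b_2,\dotsc]$ are the values of $[b_1,\dots,b_n]$ for $n=1,2,\dotsc$. An infinite EICF converges, with value $x\in\mathbb{R}_\infty$, if its sequence of convergents converges in $\mathbb{R}_\infty$ to $x$. A $1$-rational is a rational number which, written in reduced form $a/b$ (with $a,b$ coprime integers, $b>0$), has both $a$ and $b$ odd. *)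

theory Defs
  imports "HOL-Analysis.Analysis"
begin

(* R_infinity is the projectively extended real line (one point at infinity, no sign):
   None is infinity, and the topology is the one-point compactification of the reals. *)
type_synonym real_inf = "real option"

abbreviation real_inf_top :: "real_inf topology" where
  "real_inf_top \<equiv> Alexandroff_compactification euclideanreal"

(* 1/0 = infinity and 1/infinity = 0, unlike the HOL convention 1/0 = 0 *)
fun recip_inf :: "real_inf \<Rightarrow> real_inf" where
  "recip_inf None = Some 0"
| "recip_inf (Some x) = (if x = 0 then None else Some (1 / x))"

(* int + infinity = infinity *)
definition add_inf :: "int \<Rightarrow> real_inf \<Rightarrow> real_inf" where
  "add_inf n y = map_option (\<lambda>x. of_int n + x) y"

(* The value of [b_1, ..., b_n].  The value infinity of the empty list is conventional. *)
fun cf_value :: "int list \<Rightarrow> real_inf" where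
  "cf_value [] = None"
| "cf_value [b] = Some (of_int b)"
| "cf_value (b # c # bs) = add_inf b (recip_inf (cf_value (c # bs)))"

(* Sequences are indexed from 0: the term b_i of [b_1, b_2, ...] is b (i - 1),
   so b 0 is the only term allowed to vanish. *)
definition infinite_EICF :: "(nat \<Rightarrow> int) \<Rightarrow> bool" where
  "infinite_EICF b \<longleftrightarrow> (\<forall>i. even (b i)) \<and> (\<forall>i\<ge>1. b i \<noteq> 0)"

(* convergent_EICF b k is the value of the first k + 1 terms *)
definition convergent_EICF :: "(nat \<Rightarrow> int) \<Rightarrow> nat \<Rightarrow> real_inf" where
  "convergent_EICF b k = cf_value (map b [0..<Suc k])"

definition EICF_has_value :: "(nat \<Rightarrow> int) \<Rightarrow> real_inf \<Rightarrow> bool" where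
  "EICF_has_value b x \<longleftrightarrow> limitin real_inf_top (convergent_EICF b) x sequentially"

definition EICF_converges :: "(nat \<Rightarrow> int) \<Rightarrow> bool" where
  "EICF_converges b \<longleftrightarrow> (\<exists>x. EICF_has_value b x)"

definition one_rational :: "real \<Rightarrow> bool" where
  "one_rational x \<longleftrightarrow>
     (\<exists>a b :: int. coprime a b \<and> b > 0 \<and> x = of_int a / of_int b \<and> odd a \<and> odd b)"

end

(* Write x_n = p_n / q_n for the n-th convergent.  Here q_(n+2) = b_(n+2) q_(n+1) + q_n with
   |b_(n+2)| \<ge> 2, so |q_n| is strictly increasing.  Hence consecutive
   convergents, whose distance is 1 / |q_n q_(n+1)|, satisfy
   |x_(n+1) - x_n| \<le> 1 / |q_n| - 1 / |q_(n+1)|: the intervals [x_n - 1 / |q_n|, x_n + 1 / |q_n|] are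
   nested, and they shrink to a limit r with |q_n r - p_n| \<le> 1.

   If r = a / c in lowest terms, the integers E_n = a q_n - c p_n are bounded by c and satisfy the
   same recurrence.  One strict increase |E_n| < |E_(n+1)| would make |E_n| grow forever, so |E_n|
   is nonincreasing.  If a and c were of opposite parity, consecutive E_n would be so too, because
   p_n and q_n alternate in parity; then |E_n| would be a strictly decreasing sequence of naturals. *)

theory Submission
  imports Defs
begin

section \<open>Numerators and denominators of convergents\<close>

(* Index n is the convergent built from n terms; index 0 is the formal convergent 1/0 = infinity. *)
fun conv_num :: "(nat \<Rightarrow> int) \<Rightarrow> nat \<Rightarrow> int" where
  "conv_num b 0 = 1"
| "conv_num b (Suc 0) = b 0"
| "conv_num b (Suc (Suc n)) = b (Suc n) * conv_num b (Suc n) + conv_num b n"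

fun conv_den :: "(nat \<Rightarrow> int) \<Rightarrow> nat \<Rightarrow> int" where
  "conv_den b 0 = 0"
| "conv_den b (Suc 0) = 1"
| "conv_den b (Suc (Suc n)) = b (Suc n) * conv_den b (Suc n) + conv_den b n"

text \<open>The recurrences append a term at the end, while \<open>cf_value\<close> peels off the
  first one. This lemma and the next reconcile the two.\<close>

lemma conv_num_shift:
  "conv_num b (Suc n) = b 0 * conv_num (b \<circ> Suc) n + conv_den (b \<circ> Suc) n"
  by (induction b n rule: conv_num.induct) (auto simp: algebra_simps)

lemma conv_den_shift: "conv_den b (Suc n) = conv_num (b \<circ> Suc) n"
  by (induction b n rule: conv_num.induct) auto

text \<open>Each step of the recurrence multiplies the matrix of two consecutive convergents by a
  matrix of determinant -1.\<close>

lemma conv_det: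
  "conv_num b (Suc n) * conv_den b n - conv_num b n * conv_den b (Suc n) = (-1) ^ Suc n"
  by (induction n) (auto simp: algebra_simps)

lemma conv_num_den_not_both_0: "conv_num b n \<noteq> 0 \<or> conv_den b n \<noteq> 0"
  using conv_det[of b n] by auto

lemma cf_value_Cons: "cf_value (x # xs) = add_inf x (recip_inf (cf_value xs))"
  by (cases xs) (auto simp: add_inf_def)

text \<open>Stated for arbitrary \<open>b\<close>, because the induction removes the first term and
  needs the claim for the shifted sequence.\<close>

lemma cf_value_conv:
  "cf_value (map b [0..<n]) =
     (if conv_den b n = 0 then None else Some (of_int (conv_num b n) / of_int (conv_den b n)))"
proof (induction n arbitrary: b)
  case 0
  then show ?case by simp
next
  case (Suc n)
  define b' where "b' = b \<circ> Suc"
  have "map b [0..<Suc n] = b 0 # map b' [0..<n]"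
    unfolding b'_def
    by (simp only: upt_conv_Cons zero_less_Suc map_Suc_upt[symmetric]) simp
  then have "cf_value (map b [0..<Suc n]) = add_inf (b 0) (recip_inf (cf_value (map b' [0..<n])))"
    by (simp only: cf_value_Cons)
  \<comment> \<open>If the tail has denominator 0, its value is infinity with reciprocal 0; the
    formula agrees, since the numerator is then nonzero.\<close>
  also have "\<dots> = (if conv_num b' n = 0 then None
      else Some (of_int (b 0 * conv_num b' n + conv_den b' n) / of_int (conv_num b' n)))"
    using conv_num_den_not_both_0[of b' n] by (auto simp: Suc add_inf_def add_divide_distrib)
  finally show ?case
    by (simp only: conv_num_shift conv_den_shift b'_def)
qed

section \<open>Growth of integer solutions of the recurrence\<close>

lemma abs_less_abs_recurrence:
  fixes s0 s1 c :: int
  assumes "\<bar>s0\<bar> < \<bar>s1\<bar>" and "\<bar>c\<bar> \<ge> 2"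
  shows "\<bar>s1\<bar> < \<bar>c * s1 + s0\<bar>"
proof -
  \<comment> \<open>The triangle inequality then gives |c s1 + s0| \<ge> 2|s1| - |s0| >
    |s1|.\<close>
  have "2 * \<bar>s1\<bar> \<le> \<bar>c * s1\<bar>"
    using assms(2) by (simp add: abs_mult mult_right_mono)
  with assms(1) show ?thesis by linarith
qed

lemma abs_recurrence_strict_mono:
  fixes s c :: "nat \<Rightarrow> int"
  assumes rec: "\<And>n. s (Suc (Suc n)) = c n * s (Suc n) + s n"
    and c: "\<And>n. \<bar>c n\<bar> \<ge> 2"
    and init: "\<bar>s m\<bar> < \<bar>s (Suc m)\<bar>"
  shows "\<bar>s (m + n)\<bar> < \<bar>s (Suc (m + n))\<bar>"
  by (induction n) (use init abs_less_abs_recurrence[OF _ c] in \<open>simp_all add: rec\<close>)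

text \<open>A strict increase of integers is by at least 1. This linear growth both rules out
  bounded solutions with an increase and makes 1 / |q_n| tend to 0.\<close>

lemma abs_recurrence_ge:
  fixes s c :: "nat \<Rightarrow> int"
  assumes "\<And>n. s (Suc (Suc n)) = c n * s (Suc n) + s n"
    and "\<And>n. \<bar>c n\<bar> \<ge> 2"
    and "\<bar>s m\<bar> < \<bar>s (Suc m)\<bar>"
  shows "int n \<le> \<bar>s (m + n)\<bar>"
proof (induction n)
  case (Suc n)
  then show ?case using abs_recurrence_strict_mono[OF assms, of n] by simp
qed simp

lemma bounded_recurrence_consecutive_abs_eq:
  fixes s c :: "nat \<Rightarrow> int"
  assumes "\<And>n. s (Suc (Suc n)) = c n * s (Suc n) + s n"
    and "\<And>n. \<bar>c n\<bar> \<ge> 2"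
    and bound: "\<And>n. \<bar>s n\<bar> \<le> B"
  obtains n where "\<bar>s (Suc n)\<bar> = \<bar>s n\<bar>"
proof (rule ccontr)
  assume "\<not> thesis"
  with that have neq: "\<bar>s (Suc n)\<bar> \<noteq> \<bar>s n\<bar>" for n by blast
  \<comment> \<open>After an increase at \<open>m\<close>, the term \<open>nat (B + 1)\<close> steps
    later would exceed \<open>B\<close>.\<close>
  have "\<not> \<bar>s m\<bar> < \<bar>s (Suc m)\<bar>" for m
    using abs_recurrence_ge[of s c, OF assms(1,2), of m "nat (B + 1)"]
      bound[of "m + nat (B + 1)"] by force
  with neq have "\<bar>s (Suc n)\<bar> < \<bar>s n\<bar>" for n
    by (meson linorder_neqE)
  then have "nat \<bar>s (Suc n)\<bar> < nat \<bar>s n\<bar>" for n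
    by (simp only: nat_less_eq_zless abs_ge_zero)
  then show False
    using wf_no_infinite_down_chainE[OF wf_less_than, of "\<lambda>n. nat \<bar>s n\<bar>"]
    by (simp only: less_than_iff) blast
qed

section \<open>Convergence of the convergents\<close>

lemma infinite_EICF_abs_ge_2:
  assumes "infinite_EICF b"
  shows "\<bar>b (Suc n)\<bar> \<ge> 2"
proof -
  have "even (b (Suc n))" "b (Suc n) \<noteq> 0"
    using assms by (auto simp: infinite_EICF_def)
  then show ?thesis by presburger
qed

lemma conv_den_strict_mono:
  assumes "infinite_EICF b"
  shows "\<bar>conv_den b n\<bar> < \<bar>conv_den b (Suc n)\<bar>"
  using abs_recurrence_strict_mono[of "conv_den b" "\<lambda>n. b (Suc n)" 0 n]
    infinite_EICF_abs_ge_2[OF assms] by simp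

lemma conv_den_ge:
  assumes "infinite_EICF b"
  shows "int n \<le> \<bar>conv_den b n\<bar>"
  using abs_recurrence_ge[of "conv_den b" "\<lambda>n. b (Suc n)" 0 n]
    infinite_EICF_abs_ge_2[OF assms] by simp

lemma conv_den_nonzero:
  assumes "infinite_EICF b"
  shows "conv_den b (Suc n) \<noteq> 0"
  using conv_den_strict_mono[OF assms, of n] by auto

text \<open>With even coefficients, the recurrence modulo 2 just copies the term two places
  back.\<close>

lemma parity_conv:
  assumes "\<And>i. even (b i)"
  shows "even (conv_num b n) \<longleftrightarrow> odd n" "even (conv_den b n) \<longleftrightarrow> even n"
  by (induction n rule: induct_nat_012) (use assms in auto)

lemma convergent_EICF_eq:
  assumes "infinite_EICF b"
  shows "convergent_EICF b n = Some (of_int (conv_num b (Suc n)) / of_int (conv_den b (Suc n)))"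
  unfolding convergent_EICF_def cf_value_conv using conv_den_nonzero[OF assms] by auto

lemma convergents_dist:
  fixes b :: "nat \<Rightarrow> int"
  defines "x \<equiv> \<lambda>n. real_of_int (conv_num b (Suc n)) / of_int (conv_den b (Suc n))"
    and "u \<equiv> \<lambda>n. 1 / \<bar>real_of_int (conv_den b (Suc n))\<bar>"
  assumes "infinite_EICF b"
  shows "\<bar>x (Suc n) - x n\<bar> \<le> u n - u (Suc n)"
proof -
  define p q p' q' where "p = real_of_int (conv_num b (Suc n))"
    and "q = real_of_int (conv_den b (Suc n))"
    and "p' = real_of_int (conv_num b (Suc (Suc n)))"
    and "q' = real_of_int (conv_den b (Suc (Suc n)))"
  have q0: "q \<noteq> 0" "q' \<noteq> 0"
    using conv_den_nonzero[OF assms(3)] by (auto simp: q_def q'_def simp del: conv_den.simps)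
  have "\<bar>conv_den b (Suc n)\<bar> + 1 \<le> \<bar>conv_den b (Suc (Suc n))\<bar>"
    using conv_den_strict_mono[OF assms(3), of "Suc n"] by linarith
  then have qq: "\<bar>q\<bar> + 1 \<le> \<bar>q'\<bar>"
    unfolding q_def q'_def by linarith
  have "real_of_int (conv_num b (Suc (Suc n)) * conv_den b (Suc n)
      - conv_num b (Suc n) * conv_den b (Suc (Suc n))) = of_int ((-1) ^ Suc (Suc n))"
    by (simp only: conv_det)
  then have "p' * q - p * q' = (-1) ^ Suc (Suc n)"
    unfolding p_def q_def p'_def q'_def by (simp del: conv_num.simps conv_den.simps)
  then have det: "\<bar>p' * q - p * q'\<bar> = 1"
    by simp
  have "\<bar>p' / q' - p / q\<bar> = 1 / (\<bar>q\<bar> * \<bar>q'\<bar>)"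
    using q0 det by (simp add: diff_frac_eq abs_mult mult.commute)
  \<comment> \<open>Replacing the numerator 1 by the integer gap |q'| - |q| \<ge> 1 turns the bound
    into a telescoping difference.\<close>
  also have "\<dots> \<le> (\<bar>q'\<bar> - \<bar>q\<bar>) / (\<bar>q\<bar> * \<bar>q'\<bar>)"
    using qq q0 by (intro divide_right_mono) auto
  also have "\<dots> = 1 / \<bar>q\<bar> - 1 / \<bar>q'\<bar>"
    using q0 by (simp add: field_simps)
  finally show ?thesis
    unfolding x_def u_def p_def q_def p'_def q'_def .
qed

lemma convergents_limit:
  assumes "infinite_EICF b"
  obtains r where
    "(\<lambda>n. real_of_int (conv_num b (Suc n)) / of_int (conv_den b (Suc n))) \<longlonglongrightarrow> r"
    "\<And>n. \<bar>r * of_int (conv_den b n) - of_int (conv_num b n)\<bar> \<le> 1"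
proof -
  define x where "x n = real_of_int (conv_num b (Suc n)) / of_int (conv_den b (Suc n))" for n
  define u where "u n = 1 / \<bar>real_of_int (conv_den b (Suc n))\<bar>" for n
  have dist: "\<bar>x (Suc n) - x n\<bar> \<le> u n - u (Suc n)" for n
    unfolding x_def u_def by (rule convergents_dist[OF assms])
  have mono: "x n - u n \<le> x (Suc n) - u (Suc n)" "x (Suc n) + u (Suc n) \<le> x n + u n" for n
    using dist[of n] by linarith+
  have u_le: "u n \<le> inverse (real (Suc n))" for n
  proof -
    have "real (Suc n) \<le> \<bar>real_of_int (conv_den b (Suc n))\<bar>"
      using conv_den_ge[OF assms, of "Suc n"] by linarith
    then show ?thesis
      unfolding u_def inverse_eq_divide by (intro divide_left_mono) auto
  qed
  have u_lim: "u \<longlonglongrightarrow> 0"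
    by (rule tendsto_sandwich[OF _ _ tendsto_const LIMSEQ_inverse_real_of_nat])
      (use u_le in \<open>auto simp: u_def\<close>)
  have "(\<lambda>n. - 2 * u n) \<longlonglongrightarrow> - 2 * 0"
    by (intro tendsto_intros u_lim)
  then have gap: "(\<lambda>n. (x n - u n) - (x n + u n)) \<longlonglongrightarrow> 0"
    by simp
  have "x n - u n \<le> x n + u n" for n
    by (simp add: u_def)
  with nested_sequence_unique[of "\<lambda>n. x n - u n" "\<lambda>n. x n + u n"] mono gap
  obtain r where r: "\<And>n. x n - u n \<le> r" "\<And>n. r \<le> x n + u n" "(\<lambda>n. x n - u n) \<longlonglongrightarrow> r"
    by blast
  have "(\<lambda>n. x n - u n + u n) \<longlonglongrightarrow> r + 0"
    by (intro tendsto_add r(3) u_lim)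
  then have "x \<longlonglongrightarrow> r"
    by simp
  moreover have "\<bar>r * of_int (conv_den b n) - of_int (conv_num b n)\<bar> \<le> 1" for n
  \<comment> \<open>At index 0 the quantity is |r * 0 - 1| = 1; at later indices the interval bound
    is multiplied by |q|.\<close>
  proof (cases n)
    case (Suc m)
    define q where "q = real_of_int (conv_den b (Suc m))"
    have "q \<noteq> 0"
      using conv_den_nonzero[OF assms] by (simp add: q_def)
    have "\<bar>r - x m\<bar> \<le> 1 / \<bar>q\<bar>"
      using r(1,2)[of m] unfolding u_def q_def by linarith
    then have "\<bar>r - x m\<bar> * \<bar>q\<bar> \<le> 1"
      using \<open>q \<noteq> 0\<close> by (simp add: field_simps)
    moreover have "\<bar>r - x m\<bar> * \<bar>q\<bar> = \<bar>r * q - of_int (conv_num b (Suc m))\<bar>"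
      using \<open>q \<noteq> 0\<close> by (simp add: abs_mult[symmetric] x_def q_def[symmetric] field_simps)
    ultimately show ?thesis
      by (simp add: Suc q_def)
  qed simp
  ultimately show thesis
    using that unfolding x_def by blast
qed

section \<open>Parity of rational limits\<close>

lemma limit_one_rational:
  assumes EICF: "infinite_EICF b"
    and bound: "\<And>n. \<bar>r * of_int (conv_den b n) - of_int (conv_num b n)\<bar> \<le> 1"
    and "r \<in> \<rat>"
  shows "one_rational r"
proof -
  obtain a c :: int where ac: "c > 0" "coprime a c" "r = of_int a / of_int c"
    using Rats_cases'[OF \<open>r \<in> \<rat>\<close>] by metis
  define E where "E n = a * conv_den b n - c * conv_num b n" for n
  have "\<bar>E n\<bar> \<le> c" for n
  proof -
    have "real_of_int \<bar>E n\<bar> = c * \<bar>r * of_int (conv_den b n) - of_int (conv_num b n)\<bar>"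
    proof -
      \<comment> \<open>Multiplying the error r q_n - p_n by \<open>c\<close> clears the denominator
        of \<open>r\<close>.\<close>
      have "real_of_int (E n) = c * (r * of_int (conv_den b n) - of_int (conv_num b n))"
        using ac by (simp add: E_def algebra_simps)
      then show ?thesis
        using ac(1) by (simp add: abs_mult)
    qed
    also have "\<dots> \<le> c"
      using mult_left_mono[OF bound[of n], of c] ac(1) by simp
    finally show ?thesis by linarith
  qed
  moreover have "E (Suc (Suc n)) = b (Suc n) * E (Suc n) + E n" for n
    by (simp add: E_def algebra_simps)
  ultimately obtain n where "\<bar>E (Suc n)\<bar> = \<bar>E n\<bar>"
    using bounded_recurrence_consecutive_abs_eq[of E "\<lambda>n. b (Suc n)" c]
      infinite_EICF_abs_ge_2[OF EICF] by blast
  then have same: "even (E (Suc n)) \<longleftrightarrow> even (E n)"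
    by (metis even_abs_add_iff abs_idempotent dvd_abs_iff)
  have "\<And>i. even (b i)"
    using EICF by (simp add: infinite_EICF_def)
  \<comment> \<open>\<open>E n\<close> has the parity of \<open>c\<close> for even \<open>n\<close>
    and of \<open>a\<close> for odd \<open>n\<close>, so equal parities at consecutive indices force
    \<open>a\<close> and \<open>c\<close> to agree modulo 2.\<close>
  from parity_conv[OF this] same have "even a \<longleftrightarrow> even c"
    unfolding E_def by (cases "even n") (auto simp del: conv_num.simps conv_den.simps)
  moreover have "odd a \<or> odd c"
    using ac(2) by (metis coprime_common_divisor odd_one)
  ultimately show ?thesis
    using ac unfolding one_rational_def by blast
qed

text \<open>The embedding of the reals into their one-point compactification is continuous.\<close>

lemma limitin_real_inf_top_Some:
  assumes "f \<longlonglongrightarrow> (r :: real)"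
  shows "limitin real_inf_top (\<lambda>n. Some (f n)) (Some r) sequentially"
  using continuous_map_limit[OF continuous_map_Some, of euclideanreal f r sequentially] assms
  by (simp add: o_def)

theorem theorem2p1:
  fixes b :: "nat \<Rightarrow> int"
  assumes "infinite_EICF b"
  shows "EICF_converges b \<and>
    (\<forall>x. EICF_has_value b x \<longrightarrow> (\<exists>r::real. x = Some r \<and> (r \<notin> \<rat> \<or> one_rational r)))"
proof -
  obtain r where
    lim: "(\<lambda>n. real_of_int (conv_num b (Suc n)) / of_int (conv_den b (Suc n))) \<longlonglongrightarrow> r" and
    bound: "\<And>n. \<bar>r * of_int (conv_den b n) - of_int (conv_num b n)\<bar> \<le> 1"
    by (rule convergents_limit[OF assms]) blast
  have val: "EICF_has_value b (Some r)"
    unfolding EICF_has_value_def convergent_EICF_eq[OF assms, abs_def]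
    by (rule limitin_real_inf_top_Some[OF lim])
  \<comment> \<open>Uniqueness of limits extends the claim from \<open>Some r\<close> to every value
    and excludes infinity.\<close>
  have "Hausdorff_space real_inf_top"
    by (simp add: Hausdorff_space_Alexandroff_compactification locally_compact_space_euclidean)
  then have "x = Some r" if "EICF_has_value b x" for x
    using limitin_Hausdorff_unique that val unfolding EICF_has_value_def
    by (metis trivial_limit_sequentially)
  with val limit_one_rational[OF assms bound] show ?thesis
    unfolding EICF_converges_def by blast
qed

end
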